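(* Let $n \ge 4$ be even and let $V_1, V_2, \ldots, V_n$ be the vertices, in cyclic order, of a tangential polygon in the Euclidean plane, with side lengths $h_1 = V_1V_2$, $h_2 = V_2V_3$, $\ldots$, $h_{n-1}=V_{n-1}V_n$, $h_n = V_nV_1$. Suppose the incircle touches the side $V_nV_1$ at distance $h_0$ from $V_1$. For every odd $k$ with $1 \le k \le n-1$, extend each of the two sides ending at $V_k$ beyond $V_k$ by $$\sum\{h_i : (1 \le i < k \wedge i \text{ odd}) \vee (k < i \le n \wedge i \text{ even})\} - h_0,$$ and extend each of the two sides ending at $V_{k+1}$ beyond $V_{k+1}$ by $$\sum\{h_i : (1 \le i < k \wedge i \text{ even}) \vee (k < i \le n \wedge i \text{ odd})\} + h_0.$$ Then the $2n$ points so formed are concyclic, lying on a circle centered at the polygon's incenter.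
   Context: A tangential polygon is a convex polygon for which there is a circle (the incircle) tangent to all of its sides; the center of this circle is the incenter. Extending a side $UV$ beyond $V$ by length $x$ produces the endpoint $V + x\,\frac{V-U}{|V-U|}$. In the sums, $i$ ranges over the integers satisfying the displayed condition, and an empty sum is $0$. *)

theory Defs
  imports "HOL-Analysis.Analysis"
begin

definition cyc_succ :: "nat \<Rightarrow> nat \<Rightarrow> nat" where
  "cyc_succ n i = (if i = n then 1 else i + 1)"

definition cyc_pred :: "nat \<Rightarrow> nat \<Rightarrow> nat" where
  "cyc_pred n i = (if i = 1 then n else i - 1)"

(* The vertices are V 1, ..., V n.  The endpoints of an edge of a polytope are extreme points of it,
   so there are no straight angles; for n \<ge> 3 the hull is two-dimensional, and as its boundary is a
   single cycle of edges, the sides below are all of its edges, listed in cyclic order. *)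
definition convex_polygon :: "nat \<Rightarrow> (nat \<Rightarrow> real^2) \<Rightarrow> bool" where
  "convex_polygon n V \<longleftrightarrow>
     3 \<le> n \<and> inj_on V {1..n} \<and>
     (\<forall>i\<in>{1..n}. closed_segment (V i) (V (cyc_succ n i)) edge_of (convex hull (V ` {1..n})))"

(* The line AB meets the circle in the single point T, and T lies on the segment AB itself. *)
definition touches_side_at ::
    "real^2 \<Rightarrow> real \<Rightarrow> real^2 \<Rightarrow> real^2 \<Rightarrow> real^2 \<Rightarrow> bool" where
  "touches_side_at c r A B T \<longleftrightarrow>
     T \<in> closed_segment A B \<and> sphere c r \<inter> affine hull {A, B} = {T}"

definition incircle :: "nat \<Rightarrow> (nat \<Rightarrow> real^2) \<Rightarrow> real^2 \<Rightarrow> real \<Rightarrow> bool" where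
  "incircle n V c r \<longleftrightarrow>
     0 < r \<and> (\<forall>i\<in>{1..n}. \<exists>T. touches_side_at c r (V i) (V (cyc_succ n i)) T)"

definition tangential_polygon :: "nat \<Rightarrow> (nat \<Rightarrow> real^2) \<Rightarrow> bool" where
  "tangential_polygon n V \<longleftrightarrow> convex_polygon n V \<and> (\<exists>c r. incircle n V c r)"

definition extend_beyond :: "real^2 \<Rightarrow> real^2 \<Rightarrow> real \<Rightarrow> real^2" where
  "extend_beyond U W x = W + x *\<^sub>R ((W - U) /\<^sub>R norm (W - U))"

end

(* Let t i be the common length of the two tangents from V i to the incircle and S the sum of all
   t i.  Then h i = t i + t (i + 1) and h0 = t 1, so the sums in the statement telescope: the sides
   at V k are extended by exactly S - t k.  Every endpoint thus lies on a tangent line of the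
   incircle at distance S from the point of contact, hence at distance sqrt (r^2 + S^2) from c. *)
theory Submission
  imports Defs
begin

lemma touches_side_at_commute:
  "touches_side_at c r A B T \<longleftrightarrow> touches_side_at c r B A T"
  by (simp add: touches_side_at_def closed_segment_commute insert_commute)

text \<open>Tangency is encoded as a one-point intersection, so perpendicularity of radius and line
  has to come from uniqueness: a nonzero component of \<open>T - c\<close> along the line would
  yield a second common point.\<close>

lemma touches_side_at_orthogonal:
  assumes "touches_side_at c r A B T"
  shows "(T - c) \<bullet> (B - A) = 0"
proof (cases "A = B")
  case False
  define v where "v = B - A"
  have v: "v \<bullet> v \<noteq> 0"
    using False by (simp add: v_def)
  have "dist c Q = r \<and> Q \<in> affine hull {A, B} \<longleftrightarrow> Q = T" for Q
    using assms unfolding touches_side_at_def set_eq_iff by simp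
  then have T: "dist c T = r" "T \<in> affine hull {A, B}"
    and unique: "\<And>Q. dist c Q = r \<Longrightarrow> Q \<in> affine hull {A, B} \<Longrightarrow> Q = T"
    by blast+
  \<comment> \<open>Twice the coefficient of the projection of \<open>T - c\<close> onto
    \<open>v\<close>; the goal amounts to \<open>s = 0\<close>.\<close>
  define s where "s = 2 * ((T - c) \<bullet> v) / (v \<bullet> v)"
  \<comment> \<open>The reflection of T in the foot of the perpendicular from c is a further intersection point.\<close>
  define Q where "Q = T - s *\<^sub>R v"
  have "(Q - c) \<bullet> (Q - c) = (T - c) \<bullet> (T - c) - s * (2 * ((T - c) \<bullet> v) - s * (v \<bullet> v))"
    by (simp add: Q_def algebra_simps inner_commute)
  also have "s * (v \<bullet> v) = 2 * ((T - c) \<bullet> v)"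
    using v by (simp add: s_def)
  finally have "norm (Q - c) = norm (T - c)"
    by (simp add: norm_eq_sqrt_inner)
  then have "dist c Q = r"
    using T(1) by (simp add: dist_norm norm_minus_commute)
  moreover obtain a b where ab: "T = a *\<^sub>R A + b *\<^sub>R B" "a + b = 1"
    using T(2) by (auto simp: affine_hull_2)
  have "Q = (a + s) *\<^sub>R A + (b - s) *\<^sub>R B" "(a + s) + (b - s) = 1"
    using ab by (simp_all add: Q_def v_def algebra_simps)
  then have "Q \<in> affine hull {A, B}"
    unfolding affine_hull_2 by blast
  ultimately have "Q = T"
    using unique by blast
  then have "s = 0"
    using v by (auto simp: Q_def)
  then show ?thesis
    using v by (simp add: s_def v_def)
qed simp

text \<open>Pythagoras in the right triangle \<open>c\<close>, \<open>T\<close>, \<open>A\<close>.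
  The value mentions neither \<open>B\<close> nor \<open>T\<close>, so the two sides meeting at a
  vertex have the same tangent length there.\<close>

lemma touches_side_at_tangent_length:
  assumes "touches_side_at c r A B T"
  shows "dist A T = sqrt ((dist A c)\<^sup>2 - r\<^sup>2)"
proof -
  obtain u where u: "T = (1 - u) *\<^sub>R A + u *\<^sub>R B"
    using assms by (auto simp: touches_side_at_def in_segment)
  have AT: "A - T = (- u) *\<^sub>R (B - A)"
    by (simp add: u algebra_simps)
  have "(T - c) \<bullet> (A - T) = 0"
    unfolding AT using touches_side_at_orthogonal[OF assms] by simp
  then have "orthogonal (A - T) (T - c)"
    by (simp add: orthogonal_def inner_commute)
  from norm_add_Pythagorean[OF this] have "(dist A c)\<^sup>2 = (dist A T)\<^sup>2 + (dist T c)\<^sup>2"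
    by (simp add: dist_norm)
  moreover have "dist T c = r"
    using assms by (auto simp: touches_side_at_def dist_commute)
  ultimately show ?thesis
    by simp
qed

text \<open>The contact point lies on the segment itself, not merely on its line, so it cuts the
  side into the two tangent lengths.\<close>

lemma touches_side_at_side_length:
  assumes "touches_side_at c r A B T"
  shows "dist A B = sqrt ((dist A c)\<^sup>2 - r\<^sup>2) + sqrt ((dist B c)\<^sup>2 - r\<^sup>2)"
proof -
  have "dist A B = dist A T + dist T B"
    using assms by (simp add: touches_side_at_def flip: between between_mem_segment)
  then show ?thesis
    using touches_side_at_tangent_length[OF assms]
      touches_side_at_tangent_length[OF assms[unfolded touches_side_at_commute[of c r A]]]
    by (simp add: dist_commute)
qed

text \<open>Pythagoras with legs \<open>r\<close> and the distance along the tangent line from the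
  contact point to the new endpoint. That distance enters squared, so \<open>x\<close> may have any
  sign.\<close>

lemma dist_extend_beyond_touching:
  assumes T: "touches_side_at c r U W T" and "U \<noteq> W"
  shows "dist c (extend_beyond U W x) = sqrt (r\<^sup>2 + (sqrt ((dist W c)\<^sup>2 - r\<^sup>2) + x)\<^sup>2)"
proof -
  define e where "e = (W - U) /\<^sub>R norm (W - U)"
  have e: "norm e = 1" and WU: "W - U = norm (W - U) *\<^sub>R e"
    using \<open>U \<noteq> W\<close> by (simp_all add: e_def)
  obtain u where u: "T = (1 - u) *\<^sub>R U + u *\<^sub>R W" "u \<le> 1"
    using T by (auto simp: touches_side_at_def in_segment)
  have "W - T = (1 - u) *\<^sub>R (W - U)"
    by (simp add: u algebra_simps)
  then have WT: "W - T = ((1 - u) * norm (W - U)) *\<^sub>R e"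
    by (subst (asm) WU) simp
  \<comment> \<open>Here \<open>u \<le> 1\<close> makes the coefficient nonnegative: going from
    \<open>T\<close> to \<open>W\<close> follows \<open>e\<close>, so an extension by
    \<open>x\<close> adds to the tangent length.\<close>
  have "dist W T = (1 - u) * norm (W - U)"
    unfolding dist_norm WT using e u(2) by simp
  with WT have W: "W = T + dist W T *\<^sub>R e"
    by (metis add.commute diff_add_cancel)
  have ext: "extend_beyond U W x - c = (dist W T + x) *\<^sub>R e + (T - c)"
    unfolding extend_beyond_def e_def[symmetric] by (subst W) (simp add: algebra_simps)
  have "(T - c) \<bullet> e = 0"
    using touches_side_at_orthogonal[OF T] by (simp add: e_def)
  then have "orthogonal ((dist W T + x) *\<^sub>R e) (T - c)"
    by (simp add: orthogonal_def inner_commute)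
  from norm_add_Pythagorean[OF this]
  have "(norm (extend_beyond U W x - c))\<^sup>2 = (dist W T + x)\<^sup>2 + (norm (T - c))\<^sup>2"
    by (simp add: ext e)
  moreover have "norm (T - c) = r"
    using T by (auto simp: touches_side_at_def dist_norm norm_minus_commute)
  moreover have "dist W T = sqrt ((dist W c)\<^sup>2 - r\<^sup>2)"
    using touches_side_at_tangent_length T touches_side_at_commute by blast
  ultimately show ?thesis
    by (metis add.commute dist_commute dist_norm norm_ge_zero real_sqrt_unique)
qed

text \<open>The pairs \<open>{i, Suc i}\<close> with \<open>i\<close> of the parity of
  \<open>a\<close> tile the interval; each induction step appends one pair.\<close>

lemma sum_adjacent_pairs:
  fixes f :: "nat \<Rightarrow> 'a::comm_monoid_add"
  shows "(\<Sum>i | a \<le> i \<and> i < a + 2 * m \<and> (even i \<longleftrightarrow> even a). f i + f (Suc i)) = sum f {a..<a + 2 * m}"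
proof (induction m)
  case (Suc m)
  have "{i. a \<le> i \<and> i < a + 2 * Suc m \<and> (even i \<longleftrightarrow> even a)} =
      insert (a + 2 * m) {i. a \<le> i \<and> i < a + 2 * m \<and> (even i \<longleftrightarrow> even a)}"
    by (auto simp: less_Suc_eq)
  then show ?case
    using Suc by (simp add: add_ac)
qed (auto intro!: sum.neutral)

text \<open>Pairs starting at odd \<open>i < k\<close> tile \<open>{1..<k}\<close>, and pairs
  starting at even \<open>i > k\<close> tile \<open>{k + 1..<n + 2}\<close>. Only \<open>k\<close>
  is skipped, while the last pair overshoots to \<open>Suc n\<close>; this surplus is what
  subtracting \<open>h0\<close> removes in the theorem.\<close>

lemma sum_outside_vertex_odd:
  fixes t :: "nat \<Rightarrow> real"
  assumes "even n" "odd k" "1 \<le> k" "k < n"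
  shows "(\<Sum>i | (1 \<le> i \<and> i < k \<and> odd i) \<or> (k < i \<and> i \<le> n \<and> even i). t i + t (Suc i)) =
    sum t {1..n} - t k + t (Suc n)"
proof -
  obtain p j where n: "n = 2 * p" and k: "k = 2 * j + 1"
    using assms by (auto elim!: evenE oddE)
  have jp: "j < p"
    using assms n k by simp
  let ?A = "{i. 1 \<le> i \<and> i < 1 + 2 * j \<and> (even i \<longleftrightarrow> even (1::nat))}"
  let ?B = "{i. k + 1 \<le> i \<and> i < k + 1 + 2 * (p - j) \<and> (even i \<longleftrightarrow> even (k + 1))}"
  have split: "{i. (1 \<le> i \<and> i < k \<and> odd i) \<or> (k < i \<and> i \<le> n \<and> even i)} = ?A \<union> ?B"
    using n k jp by (auto; presburger)
  have bounds: "1 + 2 * j = k" "k + 1 + 2 * (p - j) = n + 2"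
    using n k jp by auto
  have "(\<Sum>i\<in>?A \<union> ?B. t i + t (Suc i)) = (\<Sum>i\<in>?A. t i + t (Suc i)) + (\<Sum>i\<in>?B. t i + t (Suc i))"
    using k by (intro sum.union_disjoint) auto
  then have "(\<Sum>i\<in>?A \<union> ?B. t i + t (Suc i)) = sum t {1..<k} + sum t {k + 1..<n + 2}"
    unfolding sum_adjacent_pairs unfolding bounds .
  \<comment> \<open>The upper bound is one less than in the tiling above; the difference is the term
    \<open>t (Suc n)\<close>.\<close>
  moreover have "{1..n} = insert k ({1..<k} \<union> {k + 1..<n + 1})"
    using assms by auto
  then have "sum t {1..n} = t k + (sum t {1..<k} + sum t {k + 1..<n + 1})"
    by (simp add: sum.union_disjoint ivl_disj_int)
  ultimately show ?thesis
    unfolding split using assms by simp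
qed

text \<open>Now the pairs tile \<open>{2..<k + 1}\<close> and \<open>{k + 2..<n + 1}\<close>,
  missing \<open>k + 1\<close> and also 1; adding \<open>h0\<close> in the theorem restores the
  latter.\<close>

lemma sum_outside_vertex_even:
  fixes t :: "nat \<Rightarrow> real"
  assumes "even n" "odd k" "1 \<le> k" "k < n"
  shows "(\<Sum>i | (1 \<le> i \<and> i < k \<and> even i) \<or> (k < i \<and> i \<le> n \<and> odd i). t i + t (Suc i)) =
    sum t {1..n} - t (k + 1) - t 1"
proof -
  obtain p j where n: "n = 2 * p" and k: "k = 2 * j + 1"
    using assms by (auto elim!: evenE oddE)
  have jp: "j < p"
    using assms n k by simp
  let ?A = "{i. 2 \<le> i \<and> i < 2 + 2 * j \<and> (even i \<longleftrightarrow> even (2::nat))}"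
  \<comment> \<open>As \<open>k\<close> is odd, the first odd index beyond it is
    \<open>k + 2\<close>.\<close>
  let ?B = "{i. k + 2 \<le> i \<and> i < k + 2 + 2 * (p - j - 1) \<and> (even i \<longleftrightarrow> even (k + 2))}"
  have split: "{i. (1 \<le> i \<and> i < k \<and> even i) \<or> (k < i \<and> i \<le> n \<and> odd i)} = ?A \<union> ?B"
    using n k jp by (auto; presburger)
  have bounds: "2 + 2 * j = k + 1" "k + 2 + 2 * (p - j - 1) = n + 1"
    using n k jp by auto
  have "(\<Sum>i\<in>?A \<union> ?B. t i + t (Suc i)) = (\<Sum>i\<in>?A. t i + t (Suc i)) + (\<Sum>i\<in>?B. t i + t (Suc i))"
    using k by (intro sum.union_disjoint) auto
  then have "(\<Sum>i\<in>?A \<union> ?B. t i + t (Suc i)) = sum t {2..<k + 1} + sum t {k + 2..<n + 1}"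
    unfolding sum_adjacent_pairs unfolding bounds .
  moreover have "{1..n} = insert 1 (insert (k + 1) ({2..<k + 1} \<union> {k + 2..<n + 1}))"
    using assms by auto
  then have "sum t {1..n} = t 1 + (t (k + 1) + (sum t {2..<k + 1} + sum t {k + 2..<n + 1}))"
    using assms by (simp add: sum.union_disjoint ivl_disj_int)
  ultimately show ?thesis
    unfolding split by simp
qed

theorem theorem3:
  fixes n :: nat and V :: "nat \<Rightarrow> real^2" and h :: "nat \<Rightarrow> real" and h0 r :: real
    and c T :: "real^2"
  assumes "4 \<le> n" and "even n"
    and "tangential_polygon n V"
    and "incircle n V c r"
    and "\<forall>i\<in>{1..n}. h i = dist (V i) (V (cyc_succ n i))"
    and "touches_side_at c r (V n) (V 1) T"
    and "h0 = dist (V 1) T"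
  shows "\<exists>R>0. \<forall>k\<in>{1..n-1}. odd k \<longrightarrow>
     (let x = (\<Sum>i | (1 \<le> i \<and> i < k \<and> odd i) \<or> (k < i \<and> i \<le> n \<and> even i). h i) - h0;
          y = (\<Sum>i | (1 \<le> i \<and> i < k \<and> even i) \<or> (k < i \<and> i \<le> n \<and> odd i). h i) + h0
      in {extend_beyond (V (cyc_pred n k)) (V k) x,
          extend_beyond (V (k + 1)) (V k) x,
          extend_beyond (V k) (V (k + 1)) y,
          extend_beyond (V (cyc_succ n (k + 1))) (V (k + 1)) y} \<subseteq> sphere c R)"
proof -
  define l where "l A = sqrt ((dist A c)\<^sup>2 - r\<^sup>2)" for A
  \<comment> \<open>Index \<open>Suc n\<close> wraps around to 1, so that
    \<open>h i = t i + t (Suc i)\<close> also holds for the closing side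
    \<open>i = n\<close>.\<close>
  define t where "t i = l (V (if i = Suc n then 1 else i))" for i
  define S where "S = sum t {1..n}"
  define R where "R = sqrt (r\<^sup>2 + S\<^sup>2)"
  have r: "0 < r" and touch: "\<exists>T. touches_side_at c r (V i) (V (cyc_succ n i)) T" if "i \<in> {1..n}" for i
    using assms(4) that by (auto simp: incircle_def)
  have inj: "inj_on V {1..n}"
    using assms(3) by (simp add: tangential_polygon_def convex_polygon_def)
  have h: "h i = t i + t (Suc i)" if "i \<in> {1..n}" for i
  proof -
    have "h i = l (V i) + l (V (cyc_succ n i))"
      using assms(5) touch[OF that] that touches_side_at_side_length by (auto simp: l_def)
    then show ?thesis
      using that by (auto simp: t_def cyc_succ_def)
  qed
  have h0: "h0 = t 1" "t (Suc n) = t 1"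
    using assms(1,6,7) touches_side_at_tangent_length[of c r "V 1" "V n" T]
    by (auto simp: t_def l_def touches_side_at_commute[of c r "V n"])
  \<comment> \<open>The extension happens at \<open>V j\<close>; the disjunction covers both sides
    ending there.\<close>
  have on_circle: "extend_beyond (V i) (V j) (S - t j) \<in> sphere c R"
    if ij: "i \<in> {1..n}" "j \<in> {1..n}" "j = cyc_succ n i \<or> i = cyc_succ n j" for i j
  proof -
    \<comment> \<open>Distinct endpoints are needed for \<open>extend_beyond\<close> to have a
      genuine unit direction.\<close>
    have "i \<noteq> j"
      using ij assms(1) by (auto simp: cyc_succ_def split: if_splits)
    then have "V i \<noteq> V j"
      using inj ij by (auto dest: inj_onD)
    moreover obtain T where "touches_side_at c r (V i) (V j) T"
      using ij touch[of i] touch[of j] touches_side_at_commute[of c r "V i"] by auto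
    moreover have "t j = l (V j)"
      using ij by (auto simp: t_def)
    ultimately show ?thesis
      using dist_extend_beyond_touching[of c r "V i" "V j" _ "S - t j"] by (simp add: R_def l_def)
  qed
  have "0 < R"
    using r[of 1] assms(1) by (simp add: R_def add_pos_nonneg)
  moreover have "let x = (\<Sum>i | (1 \<le> i \<and> i < k \<and> odd i) \<or> (k < i \<and> i \<le> n \<and> even i). h i) - h0;
          y = (\<Sum>i | (1 \<le> i \<and> i < k \<and> even i) \<or> (k < i \<and> i \<le> n \<and> odd i). h i) + h0
      in {extend_beyond (V (cyc_pred n k)) (V k) x,
          extend_beyond (V (k + 1)) (V k) x,
          extend_beyond (V k) (V (k + 1)) y,
          extend_beyond (V (cyc_succ n (k + 1))) (V (k + 1)) y} \<subseteq> sphere c R"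
    if k: "k \<in> {1..n-1}" "odd k" for k
  proof -
    have kn: "1 \<le> k" "k < n"
      using k assms(1) by auto
    have "(\<Sum>i | (1 \<le> i \<and> i < k \<and> odd i) \<or> (k < i \<and> i \<le> n \<and> even i). h i) - h0 =
        (\<Sum>i | (1 \<le> i \<and> i < k \<and> odd i) \<or> (k < i \<and> i \<le> n \<and> even i). t i + t (Suc i)) - h0"
      using kn by (intro arg_cong2[where f = "(-)"] sum.cong refl h) auto
    also have "\<dots> = S - t k"
      using sum_outside_vertex_odd[OF assms(2) k(2) kn] h0 by (simp add: S_def)
    finally have x: "(\<Sum>i | (1 \<le> i \<and> i < k \<and> odd i) \<or> (k < i \<and> i \<le> n \<and> even i). h i) - h0 = S - t k" .
    have "(\<Sum>i | (1 \<le> i \<and> i < k \<and> even i) \<or> (k < i \<and> i \<le> n \<and> odd i). h i) + h0 =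
        (\<Sum>i | (1 \<le> i \<and> i < k \<and> even i) \<or> (k < i \<and> i \<le> n \<and> odd i). t i + t (Suc i)) + h0"
      using kn by (intro arg_cong2[where f = "(+)"] sum.cong refl h) auto
    also have "\<dots> = S - t (k + 1)"
      using sum_outside_vertex_even[OF assms(2) k(2) kn] h0 by (simp add: S_def)
    finally have y: "(\<Sum>i | (1 \<le> i \<and> i < k \<and> even i) \<or> (k < i \<and> i \<le> n \<and> odd i). h i) + h0 = S - t (k + 1)" .
    \<comment> \<open>Four instances of \<open>on_circle\<close>. Wrap-around occurs at
      \<open>k = 1\<close>, whose predecessor is \<open>n\<close>, and at \<open>k = n - 1\<close>,
      where the successor of \<open>k + 1\<close> is 1.\<close>
    show ?thesis
      unfolding x y Let_def insert_subset
      using kn by (intro conjI on_circle empty_subsetI) (auto simp: cyc_succ_def cyc_pred_def)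
  qed
  ultimately show ?thesis
    by blast
qed

end
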